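(* Let $Q(x,dy) = q(x,y)\,dy$ be a Markov transition kernel on $\mathbb{R}^n$ with (jointly measurable, nonnegative) density $q$ with respect to Lebesgue measure, and let $\pi:\mathbb{R}^n\to[0,\infty)$ be the (not necessarily normalized) Lebesgue density of a finite nonzero measure on $\mathbb{R}^n$. Let $\gamma:\mathbb{R}^n\times\mathbb{R}^n\to\mathbb{R}$ be Lebesgue measurable and suppose that (1) $\gamma(x,y)=-\gamma(y,x)$ for all $x,y\in\mathbb{R}^n$; (2) $\int_{A\times\mathbb{R}^n}\gamma(x,y)\,dx\,dy=0$ for all Borel sets $A\subset \mathbb{R}^n$; (3) $\gamma(x,y)=0$ for all $x,y\in\mathbb{R}^n$ for which $\pi(x)q(x,y)=0$; (4) for all $x,y\in\mathbb{R}^n$, $\pi(x)q(x,y)=0$ if and only if $\pi(y)q(y,x)=0$; (5) $\gamma(x,y)+\pi(y)q(y,x)\ge 0$ for all $x,y\in\mathbb{R}^n$ for which $\pi(x)q(x,y)\neq 0$. Define $$R(x,y)=\frac{\gamma(x,y)+\pi(y)q(y,x)}{\pi(x)q(x,y)}\ \text{ if }\pi(x)q(x,y)\ne 0,\qquad R(x,y)=1\ \text{ if }\pi(x)q(x,y)=0,$$ $A(x,y)=\min(1,R(x,y))$, and, for $x\in\mathbb{R}^n$ and Borel $B\subset\mathbb{R}^n$, $$P(x,B)=\int_B A(x,y)q(x,y)\,dy+\left(1-\int_{\mathbb{R}^n}A(x,y)q(x,y)\,dy\right)\mathbf{1}_{x\in B}.$$ Then $P$ is a Markov transition kernel with invariant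 density $\pi$, i.e. $\int_{\mathbb{R}^n}\pi(x)P(x,B)\,dx=\int_B\pi(x)\,dx$ for all Borel $B\subset\mathbb{R}^n$.
   Context: $\mathbf{1}_{x\in B}$ equals $1$ if $x\in B$ and $0$ otherwise. A Markov transition kernel is a map $P(x,B)$ that is a probability measure in $B$ for each $x$ and measurable in $x$ for each measurable $B$.
   Formalization: It is assumed in addition that y ↦ A(x,y)q(x,y) is Lebesgue measurable for every x, since otherwise P(x,B) is undefined; P(·,B) is shown Lebesgue measurable in general, and Borel measurable when π, q and γ are Borel. *)

theory Defs
  imports "HOL-Probability.Probability"
begin

definition markov_kernel :: "'a measure \<Rightarrow> 'b measure \<Rightarrow> ('a \<Rightarrow> 'b set \<Rightarrow> real) \<Rightarrow> bool" where
  "markov_kernel M N P \<longleftrightarrow>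
     (\<forall>x\<in>space M. \<exists>\<mu>. prob_space \<mu> \<and> sets \<mu> = sets N \<and> (\<forall>B\<in>sets N. P x B = measure \<mu> B)) \<and>
     (\<forall>B\<in>sets N. (\<lambda>x. P x B) \<in> borel_measurable M)"

text \<open>
  All integrals are Bochner integrals, which are 0 for functions that are not integrable.
  In particular, if \<open>density_kernel q\<close> is a Markov kernel, then
  \<open>Q(x, UNIV) = 1\<close> forces every section \<open>q x\<close> to be measurable and integrable.
\<close>

definition density_kernel :: "('a::euclidean_space \<Rightarrow> 'a \<Rightarrow> real) \<Rightarrow> 'a \<Rightarrow> 'a set \<Rightarrow> real" where
  "density_kernel q x B = (LINT y:B|lebesgue. q x y)"

definition hastings_ratio ::
    "('a \<Rightarrow> real) \<Rightarrow> ('a \<Rightarrow> 'a \<Rightarrow> real) \<Rightarrow> ('a \<Rightarrow> 'a \<Rightarrow> real) \<Rightarrow> 'a \<Rightarrow> 'a \<Rightarrow> real" where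
  "hastings_ratio \<pi> q \<gamma> x y =
     (if \<pi> x * q x y \<noteq> 0 then (\<gamma> x y + \<pi> y * q y x) / (\<pi> x * q x y) else 1)"

definition acceptance ::
    "('a \<Rightarrow> real) \<Rightarrow> ('a \<Rightarrow> 'a \<Rightarrow> real) \<Rightarrow> ('a \<Rightarrow> 'a \<Rightarrow> real) \<Rightarrow> 'a \<Rightarrow> 'a \<Rightarrow> real" where
  "acceptance \<pi> q \<gamma> x y = min 1 (hastings_ratio \<pi> q \<gamma> x y)"

definition nrmh_kernel ::
    "('a::euclidean_space \<Rightarrow> real) \<Rightarrow> ('a \<Rightarrow> 'a \<Rightarrow> real) \<Rightarrow> ('a \<Rightarrow> 'a \<Rightarrow> real)
       \<Rightarrow> 'a \<Rightarrow> 'a set \<Rightarrow> real" where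
  "nrmh_kernel \<pi> q \<gamma> x B =
     (LINT y:B|lebesgue. acceptance \<pi> q \<gamma> x y * q x y)
     + (1 - (LINT y|lebesgue. acceptance \<pi> q \<gamma> x y * q x y)) * indicator B x"

text \<open>
  If the data are only Lebesgue measurable on the product space, the integrands defining
  \<open>nrmh_kernel \<pi> q \<gamma> x\<close> may fail to be measurable for \<open>x\<close> in a null set, since sections of
  a Lebesgue measurable function need not be measurable. The following predicate says that
  the integrals make sense for every \<open>x\<close>; it is automatic for Borel measurable data.
\<close>

definition nrmh_well_defined ::
    "('a::euclidean_space \<Rightarrow> real) \<Rightarrow> ('a \<Rightarrow> 'a \<Rightarrow> real) \<Rightarrow> ('a \<Rightarrow> 'a \<Rightarrow> real) \<Rightarrow> bool" where
  "nrmh_well_defined \<pi> q \<gamma> \<longleftrightarrow>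
     (\<forall>x. (\<lambda>y. acceptance \<pi> q \<gamma> x y * q x y) \<in> borel_measurable lebesgue)"

end

theory Submission
  imports Defs
begin

text \<open>
  Write \<open>a x y = acceptance \<pi> q \<gamma> x y * q x y\<close> for the density of the accepted moves and
  \<open>s x y = \<pi> x * a x y\<close> for the accepted flow of mass from \<open>x\<close> to \<open>y\<close>.

  The kernel moves with density \<open>a x\<close> and puts the remaining mass \<open>1 - \<integral> a x\<close> on the point
  \<open>x\<close>. Since \<open>0 \<le> a x \<le> q x\<close> and \<open>q x\<close> is a probability density, this is a probability measure
  (\<open>prob_space_density_plus_atom\<close>).

  Invariance is conservation of flow. On the support of \<open>\<pi> x * q x y\<close>, multiplying the
  minimum in the acceptance probability by this product gives
  \<open>s x y = min (\<pi> x * q x y) (\<gamma> x y + \<pi> y * q y x)\<close>. As \<open>\<gamma>\<close> is antisymmetric, subtracting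
  \<open>\<gamma> x y\<close> from both entries gives, in reverse order, the entries of the minimum for \<open>s y x\<close>.
  Hence \<open>s x y - s y x = \<gamma> x y\<close>: \<open>\<gamma>\<close> is exactly the defect of detailed balance.
  Integrating over \<open>x \<in> B\<close>, the flow out of \<open>B\<close> and the flow into \<open>B\<close> differ by
  \<open>\<integral>\<^bsub>B \<times> UNIV\<^esub> \<gamma> = 0\<close>. So the accepted moves leave the mass of every \<open>B\<close> unchanged, and the
  rejected moves do not move any mass.

  The analytic content is that \<open>s\<close> is integrable on the product, which follows from
  \<open>\<integral> s x y dy \<le> \<pi> x\<close>, and that Fubini's theorem and the exchange of variables apply to it.
  The functions are only Lebesgue measurable, and the completed measure on the product space is
  not the product of the completed measures. Each function on the product is therefore compared
  with a Borel function that agrees with it almost everywhere; almost every section then agrees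
  almost everywhere with a Borel section, so nothing changes after integration.
\<close>

section \<open>Fubini's theorem for the completed Lebesgue measure\<close>

text \<open>
  Measurability of \<open>f\<close> comes from completeness: its preimages differ from those of \<open>g\<close> only on
  subsets of a null set.
\<close>

lemma AE_eq_borel_imp_lebesgue:
  fixes f g :: "'a::euclidean_space \<Rightarrow> real"
  assumes g: "g \<in> borel_measurable borel" and eq: "AE x in lborel. f x = g x"
  shows lebesgue_measurable_AE_eq_borel: "f \<in> borel_measurable lebesgue"
    and lebesgue_integrable_AE_eq_borel: "integrable lebesgue f \<longleftrightarrow> integrable lborel g"
    and lebesgue_integral_AE_eq_borel: "integral\<^sup>L lebesgue f = integral\<^sup>L lborel g"
proof -
  have g': "g \<in> borel_measurable lebesgue"
    using g by (intro measurable_completion) simp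
  have eq': "AE x in lebesgue. f x = g x"
    using eq by (rule AE_completion)
  show f: "f \<in> borel_measurable lebesgue"
  proof (rule measurableI)
    fix S :: "real set" assume S: "S \<in> sets borel"
    have gS: "g -` S \<inter> space lebesgue \<in> sets lebesgue"
      using g' S by (rule measurable_sets)
    have "AE x in lebesgue. x \<in> g -` S \<inter> space lebesgue \<longleftrightarrow> x \<in> f -` S \<inter> space lebesgue"
      using eq' by eventually_elim simp
    then show "f -` S \<inter> space lebesgue \<in> sets lebesgue"
      using gS by (rule completion.in_sets_AE) simp
  qed simp
  show "integrable lebesgue f \<longleftrightarrow> integrable lborel g"
    using integrable_cong_AE[OF f g' eq'] integrable_completion[of g lborel] g by simp
  show "integral\<^sup>L lebesgue f = integral\<^sup>L lborel g"
    using integral_cong_AE[OF f g' eq'] integral_completion[of g lborel] g by simp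
qed

text \<open>
  The exceptional set is contained in a Borel null set of the product, and almost all sections of
  such a set are null; this gives the second, iterated form of the agreement.
\<close>
lemma lebesgue_prod_borel_representative:
  fixes f :: "'a::euclidean_space \<times> 'b::euclidean_space \<Rightarrow> real"
  assumes "f \<in> borel_measurable lebesgue"
  obtains g where "g \<in> borel_measurable borel" "AE p in lborel. f p = g p"
    "AE x in lborel. AE y in lborel. f (x, y) = g (x, y)"
proof -
  obtain g where g: "g \<in> borel_measurable lborel" and eq: "AE p in lborel. f p = g p"
    using completion_ex_borel_measurable_real[OF assms] by blast
  have "AE p in lborel \<Otimes>\<^sub>M lborel. f p = g p"
    using eq unfolding lborel_prod .
  from lborel_pair.AE_pair[OF this] g eq show thesis
    by (intro that[of g]) auto
qed

lemma borel_section_integral_measurable: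
  fixes g :: "'a::euclidean_space \<times> 'b::euclidean_space \<Rightarrow> real"
  assumes g: "g \<in> borel_measurable borel"
  shows "(\<lambda>x. LINT y|lborel. g (x, y)) \<in> borel_measurable borel"
    and "(\<lambda>y. g (x, y)) \<in> borel_measurable borel"
proof -
  have [measurable]: "g \<in> borel_measurable (borel \<Otimes>\<^sub>M borel)"
    using g by (simp add: borel_prod)
  have "(\<lambda>x. LINT y|lborel. g (x, y)) \<in> borel_measurable lborel"
    by measurable
  then show "(\<lambda>x. LINT y|lborel. g (x, y)) \<in> borel_measurable borel" by simp
  show "(\<lambda>y. g (x, y)) \<in> borel_measurable borel" by measurable
qed

text \<open>
  For \<open>x\<close> in a null set the section may fail to be measurable and its integral takes the
  default value 0. This cannot destroy Lebesgue measurability in \<open>x\<close>.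
\<close>
lemma lebesgue_section_integral_measurable:
  fixes f :: "'a::euclidean_space \<times> 'b::euclidean_space \<Rightarrow> real"
  assumes "f \<in> borel_measurable lebesgue"
  shows "(\<lambda>x. LINT y|lebesgue. f (x, y)) \<in> borel_measurable lebesgue"
proof -
  obtain g where g: "g \<in> borel_measurable borel" and "AE p in lborel. f p = g p"
    and ae: "AE x in lborel. AE y in lborel. f (x, y) = g (x, y)"
    by (rule lebesgue_prod_borel_representative[OF assms])
  have "AE x in lborel. (LINT y|lebesgue. f (x, y)) = (LINT y|lborel. g (x, y))"
    using ae
    by eventually_elim
      (rule lebesgue_integral_AE_eq_borel[OF borel_section_integral_measurable(2)[OF g]])
  with borel_section_integral_measurable(1)[OF g] show ?thesis
    by (rule lebesgue_measurable_AE_eq_borel)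
qed

lemma lebesgue_Fubini:
  fixes f :: "'a::euclidean_space \<times> 'b::euclidean_space \<Rightarrow> real"
  assumes f: "integrable lebesgue f"
  shows lebesgue_Fubini_integrable: "integrable lebesgue (\<lambda>x. LINT y|lebesgue. f (x, y))"
    and lebesgue_Fubini_integral:
      "(LINT x|lebesgue. LINT y|lebesgue. f (x, y)) = integral\<^sup>L lebesgue f"
proof -
  obtain g where g: "g \<in> borel_measurable borel" and eq: "AE p in lborel. f p = g p"
    and ae: "AE x in lborel. AE y in lborel. f (x, y) = g (x, y)"
    by (rule lebesgue_prod_borel_representative[OF borel_measurable_integrable[OF f]])
  have ae': "AE x in lborel. (LINT y|lebesgue. f (x, y)) = (LINT y|lborel. g (x, y))"
    using ae
    by eventually_elim
      (rule lebesgue_integral_AE_eq_borel[OF borel_section_integral_measurable(2)[OF g]])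
  note F = AE_eq_borel_imp_lebesgue[OF borel_section_integral_measurable(1)[OF g] ae']
  have int_g: "integrable (lborel \<Otimes>\<^sub>M lborel) g"
    using f lebesgue_integrable_AE_eq_borel[OF g eq] by (simp add: lborel_prod)
  show "integrable lebesgue (\<lambda>x. LINT y|lebesgue. f (x, y))"
    using lborel_pair.integrable_fst'[OF int_g] F(2) by blast
  show "(LINT x|lebesgue. LINT y|lebesgue. f (x, y)) = integral\<^sup>L lebesgue f"
    using lborel_pair.integral_fst'[OF int_g] F(3) lebesgue_integral_AE_eq_borel[OF g eq]
    by (simp add: lborel_prod)
qed

text \<open>
  The converse direction, Tonelli's criterion: for nonnegative functions a finite iterated
  integral yields integrability on the product.
\<close>
lemma lebesgue_prod_integrableI:
  fixes f :: "'a::euclidean_space \<times> 'b::euclidean_space \<Rightarrow> real"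
  assumes f: "f \<in> borel_measurable lebesgue" and nonneg: "\<And>p. f p \<ge> 0"
    and sections: "\<And>x. integrable lebesgue (\<lambda>y. f (x, y))"
    and iterated: "integrable lebesgue (\<lambda>x. LINT y|lebesgue. f (x, y))"
  shows "integrable lebesgue f"
proof -
  obtain g where g: "g \<in> borel_measurable borel" and eq: "AE p in lborel. f p = g p"
    and ae: "AE x in lborel. AE y in lborel. f (x, y) = g (x, y)"
    by (rule lebesgue_prod_borel_representative[OF f])
  have g_abs: "(\<lambda>p. norm (g p)) \<in> borel_measurable borel"
    using g by measurable
  have "AE x in lborel. (LINT y|lebesgue. f (x, y)) = (LINT y|lborel. norm (g (x, y)))"
    using ae
  proof eventually_elim
    case (elim x)
    have "AE y in lborel. f (x, y) = norm (g (x, y))"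
      using elim
    proof eventually_elim
      case (elim y)
      then show ?case using nonneg[of "(x, y)"] by simp
    qed
    then show ?case
      by (rule lebesgue_integral_AE_eq_borel[OF borel_section_integral_measurable(2)[OF g_abs]])
  qed
  from lebesgue_integrable_AE_eq_borel[OF borel_section_integral_measurable(1)[OF g_abs] this]
  have 1: "integrable lborel (\<lambda>x. LINT y|lborel. norm (g (x, y)))"
    using iterated by blast
  have 2: "AE x in lborel. integrable lborel (\<lambda>y. g (x, y))"
    using ae
  proof eventually_elim
    case (elim x)
    from lebesgue_integrable_AE_eq_borel[OF borel_section_integral_measurable(2)[OF g] this]
    show ?case
      using sections by blast
  qed
  have "integrable (lborel \<Otimes>\<^sub>M lborel) g"
    using g 1 2 by (intro lborel_pair.Fubini_integrable) (simp_all add: lborel_prod)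
  then show ?thesis
    using lebesgue_integrable_AE_eq_borel[OF g eq] by (simp add: lborel_prod)
qed

section \<open>Projection and exchange of variables\<close>

text \<open>
  Lebesgue sets are Borel sets up to null sets, so a Borel map is measurable between the completed
  measures as soon as preimages of null sets are null. For the projection, the preimage of \<open>N\<close> is
  \<open>N \<times> UNIV\<close>.
\<close>
lemma lebesgue_measurable_fst: "fst \<in> (lebesgue :: ('a::euclidean_space \<times> 'b::euclidean_space) measure) \<rightarrow>\<^sub>M lebesgue"
proof (rule completion.measurable_completion2)
  show meas: "fst \<in> (lebesgue :: ('a \<times> 'b) measure) \<rightarrow>\<^sub>M lborel"
    by (intro measurable_completion)
      (simp add: measurable_lborel1 borel_measurable_continuous_onI continuous_on_fst)
  show "null_sets lborel \<subseteq> null_sets (distr (lebesgue :: ('a \<times> 'b) measure) lborel fst)"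
  proof
    fix N :: "'a set" assume N: "N \<in> null_sets lborel"
    then have Nb: "N \<in> sets borel" by auto
    have "fst -` N = N \<times> (UNIV :: 'b set)" by auto
    moreover have "emeasure (lborel :: ('a \<times> 'b) measure) (N \<times> UNIV) = 0"
      using N Nb by (subst lborel_prod[symmetric])
        (simp add: lborel.emeasure_pair_measure_Times null_setsD1)
    moreover have "N \<times> UNIV \<in> sets (borel :: ('a \<times> 'b) measure)"
      using Nb by (simp add: borel_prod[symmetric])
    ultimately show "N \<in> null_sets (distr (lebesgue :: ('a \<times> 'b) measure) lborel fst)"
      using Nb meas by (simp add: null_sets_def emeasure_distr)
  qed
qed

lemma lborel_swap: "distr lborel borel prod.swap = (lborel :: ('a::euclidean_space \<times> 'b::euclidean_space) measure)"
proof -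
  have "distr (lborel \<Otimes>\<^sub>M lborel :: ('b \<times> 'a) measure) (lborel \<Otimes>\<^sub>M lborel) (\<lambda>(x, y). (y, x)) = lborel \<Otimes>\<^sub>M lborel"
    by (rule lborel_pair.distr_pair_swap[symmetric])
  moreover have "distr lborel borel prod.swap = distr (lborel :: ('b \<times> 'a) measure) lborel (\<lambda>(x, y). (y, x))"
    by (rule distr_cong) auto
  ultimately show ?thesis by (simp add: lborel_prod)
qed

lemma borel_measurable_swap: "prod.swap \<in> (borel :: ('b::euclidean_space \<times> 'a::euclidean_space) measure) \<rightarrow>\<^sub>M borel"
  by (intro borel_measurable_continuous_onI continuous_on_swap)

lemma lebesgue_measurable_swap:
  "prod.swap \<in> (lebesgue :: ('b::euclidean_space \<times> 'a::euclidean_space) measure) \<rightarrow>\<^sub>M lebesgue"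
proof (rule completion.measurable_completion2)
  have *: "prod.swap \<in> (lborel :: ('b \<times> 'a) measure) \<rightarrow>\<^sub>M lborel"
    using borel_measurable_swap by (simp add: measurable_lborel1)
  then show "prod.swap \<in> (lebesgue :: ('b \<times> 'a) measure) \<rightarrow>\<^sub>M lborel"
    by (rule measurable_completion)
  have "distr (lebesgue :: ('b \<times> 'a) measure) lborel prod.swap = distr lborel borel prod.swap"
    using * by (simp add: distr_completion cong: distr_cong)
  then show "null_sets lborel \<subseteq> null_sets (distr (lebesgue :: ('b \<times> 'a) measure) lborel prod.swap)"
    by (simp add: lborel_swap)
qed

lemma lebesgue_swap:
  "distr lebesgue lebesgue prod.swap = (lebesgue :: ('a::euclidean_space \<times> 'b::euclidean_space) measure)"
proof -
  have *: "prod.swap \<in> (lborel :: ('b \<times> 'a) measure) \<rightarrow>\<^sub>M lborel"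
    using borel_measurable_swap by (simp add: measurable_lborel1)
  have eq: "distr (lebesgue :: ('b \<times> 'a) measure) lborel prod.swap = lborel"
    using * lborel_swap by (simp add: distr_completion cong: distr_cong)
  have "completion (distr (lebesgue :: ('b \<times> 'a) measure) lborel prod.swap) = distr lebesgue lebesgue prod.swap"
    using measurable_completion[OF *] by (rule completion.completion_distr_eq) (simp add: eq)
  then show ?thesis by (simp add: eq)
qed

section \<open>The accepted moves and the rejection atom\<close>

text \<open>
  The witness is the set function \<open>E\<close> on the Borel sets, the sum of a measure with density and a
  scaled point mass; countable additivity is inherited from the two summands.
\<close>
lemma prob_space_density_plus_atom:
  fixes a :: "'a::euclidean_space \<Rightarrow> real"
  assumes a: "integrable lebesgue a" and nonneg: "\<And>y. a y \<ge> 0"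
    and mass: "(LINT y|lebesgue. a y) \<le> 1"
  shows "\<exists>\<mu>. prob_space \<mu> \<and> sets \<mu> = sets borel \<and>
    (\<forall>B\<in>sets borel.
       (LINT y:B|lebesgue. a y) + (1 - (LINT y|lebesgue. a y)) * indicator B x = measure \<mu> B)"
proof -
  let ?c = "1 - (LINT y|lebesgue. a y)"
  define D where "D = density lebesgue (\<lambda>y. ennreal (a y))"
  define A where "A = scale_measure (ennreal ?c) (return borel x)"
  define E where "E B = emeasure D B + emeasure A B" for B
  define \<mu> where "\<mu> = measure_of UNIV (sets (borel :: 'a measure)) E"
  have a_meas: "a \<in> borel_measurable lebesgue"
    using a by simp
  have sub: "B \<in> sets D" if "B \<in> sets borel" for B
    using that by (simp add: D_def)
  have sets_A: "sets A = sets borel" by (simp add: A_def)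
  have sets_mu: "sets \<mu> = sets borel"
    unfolding \<mu>_def using sets.sigma_sets_eq[of "borel :: 'a measure"] by simp
  have mu: "emeasure \<mu> B = E B" if B: "B \<in> sets borel" for B
  proof (rule emeasure_measure_of[OF \<mu>_def])
    show "positive (sets \<mu>) E" by (simp add: positive_def E_def)
    show "countably_additive (sets \<mu>) E"
    proof (rule countably_additiveI)
      fix F :: "nat \<Rightarrow> 'a set"
      assume F: "range F \<subseteq> sets \<mu>" "disjoint_family F"
      have "range F \<subseteq> sets D" "range F \<subseteq> sets A"
        using F sub by (auto simp: sets_mu sets_A)
      then show "(\<Sum>i. E (F i)) = E (\<Union>i. F i)"
        unfolding E_def using F(2)
        by (subst suminf_add[symmetric, OF summableI summableI]) (simp only: suminf_emeasure)
    qed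
  qed (use B sets_mu in auto)
  have val: "emeasure \<mu> B = ennreal ((LINT y:B|lebesgue. a y) + ?c * indicator B x)"
    if B: "B \<in> sets borel" for B
  proof -
    have int: "integrable lebesgue (\<lambda>y. indicator B y * a y)"
      using integrable_mult_indicator[OF sub[OF B, unfolded D_def sets_density] a] by simp
    have "emeasure D B = (\<integral>\<^sup>+y. ennreal (indicator B y * a y) \<partial>lebesgue)"
      unfolding D_def using a_meas B
      by (subst emeasure_density) (auto intro!: nn_integral_cong simp: indicator_def)
    also have "\<dots> = ennreal (LINT y|lebesgue. indicator B y * a y)"
      using int nonneg by (intro nn_integral_eq_integral) auto
    finally have D: "emeasure D B = ennreal (LINT y:B|lebesgue. a y)"
      by (simp add: set_lebesgue_integral_def)
    have A: "emeasure A B = ennreal (?c * indicator B x)"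
      using B by (simp add: A_def indicator_def)
    show ?thesis
      using mass nonneg
      by (simp add: mu[OF B] E_def D A set_lebesgue_integral_def ennreal_plus[symmetric] 
           integral_nonneg_AE del: ennreal_plus)
  qed
  have nn: "0 \<le> (LINT y:B|lebesgue. a y) + ?c * indicator B x" for B
    using mass nonneg by (simp add: set_lebesgue_integral_def)
  have "space \<mu> = UNIV"
    using sets_eq_imp_space_eq[OF sets_mu] by simp
  then have "prob_space \<mu>"
    using val[of UNIV] by (intro prob_spaceI) (simp add: set_lebesgue_integral_def)
  moreover have "(LINT y:B|lebesgue. a y) + ?c * indicator B x = measure \<mu> B"
    if "B \<in> sets borel" for B
    using val[OF that] nn[of B] by (simp add: measure_def)
  ultimately show ?thesis using sets_mu by blast
qed

text \<open>
  The measure on the pairs is arbitrary so that the lemma serves both the Lebesgue and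
  the Borel \<open>\<sigma>\<close>-algebra. Measurability of the exchanged density is a separate premise, because
  the exchange of variables need not be measurable for a general \<open>M\<close>.
\<close>
lemma acceptance_density_measurable:
  fixes \<pi> :: "'a \<Rightarrow> real" and q \<gamma> :: "'a \<Rightarrow> 'a \<Rightarrow> real" and M :: "('a \<times> 'a) measure"
  assumes "(\<lambda>p. \<pi> (fst p)) \<in> borel_measurable M" "(\<lambda>p. \<pi> (snd p)) \<in> borel_measurable M"
    and "(\<lambda>(x, y). q x y) \<in> borel_measurable M" "(\<lambda>(x, y). q y x) \<in> borel_measurable M"
    and "(\<lambda>(x, y). \<gamma> x y) \<in> borel_measurable M"
  shows "(\<lambda>(x, y). acceptance \<pi> q \<gamma> x y * q x y) \<in> borel_measurable M"
  using assms
  unfolding acceptance_def hastings_ratio_def case_prod_beta by measurable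

section \<open>Invariance of the target density\<close>

theorem theorem4p1:
  fixes \<pi> :: "real ^ 'n \<Rightarrow> real"
    and q \<gamma> :: "real ^ 'n \<Rightarrow> real ^ 'n \<Rightarrow> real"
  assumes q_measurable: "(\<lambda>(x, y). q x y) \<in> borel_measurable lebesgue"
    and q_nonneg: "\<And>x y. q x y \<ge> 0"
    and Q_kernel: "markov_kernel lebesgue borel (density_kernel q)"
    and pi_nonneg: "\<And>x. \<pi> x \<ge> 0"
    and pi_finite: "integrable lebesgue \<pi>"
    and pi_nonzero: "(LINT x|lebesgue. \<pi> x) \<noteq> 0"
    and gamma_measurable: "(\<lambda>(x, y). \<gamma> x y) \<in> borel_measurable lebesgue"
    and well_defined: "nrmh_well_defined \<pi> q \<gamma>"
    and gamma_antisym: "\<And>x y. \<gamma> x y = - \<gamma> y x"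
    and gamma_integral: "\<And>A. A \<in> sets borel \<Longrightarrow> (LINT (x, y):A \<times> UNIV|lebesgue. \<gamma> x y) = 0"
    and gamma_zero: "\<And>x y. \<pi> x * q x y = 0 \<Longrightarrow> \<gamma> x y = 0"
    and support_sym: "\<And>x y. \<pi> x * q x y = 0 \<longleftrightarrow> \<pi> y * q y x = 0"
    and gamma_bound: "\<And>x y. \<pi> x * q x y \<noteq> 0 \<Longrightarrow> \<gamma> x y + \<pi> y * q y x \<ge> 0"
  shows "markov_kernel lebesgue borel (nrmh_kernel \<pi> q \<gamma>)
    \<and> (\<pi> \<in> borel_measurable borel \<longrightarrow> (\<lambda>(x, y). q x y) \<in> borel_measurable borel
         \<longrightarrow> (\<lambda>(x, y). \<gamma> x y) \<in> borel_measurable borel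
         \<longrightarrow> markov_kernel borel borel (nrmh_kernel \<pi> q \<gamma>))
    \<and> (\<forall>B\<in>sets borel. (LINT x|lebesgue. \<pi> x * nrmh_kernel \<pi> q \<gamma> x B) = (LINT x:B|lebesgue. \<pi> x))"
proof -
  define a where "a x y = acceptance \<pi> q \<gamma> x y * q x y" for x y
  define s where "s x y = \<pi> x * a x y" for x y
  have P_eq: "nrmh_kernel \<pi> q \<gamma> x B =
      (LINT y:B|lebesgue. a x y) + (1 - (LINT y|lebesgue. a x y)) * indicator B x" for x B
    by (simp add: nrmh_kernel_def a_def)
  have ratio_nonneg: "hastings_ratio \<pi> q \<gamma> x y \<ge> 0" for x y
    using gamma_bound[of x y] pi_nonneg[of x] q_nonneg[of x y] by (simp add: hastings_ratio_def)
  have a_nonneg: "0 \<le> a x y" and a_le: "a x y \<le> q x y" for x y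
    using ratio_nonneg[of x y] q_nonneg[of x y]
    by (simp_all add: a_def acceptance_def mult_left_le_one_le)

  have q_mass: "(LINT y|lebesgue. q x y) = 1" for x
  proof -
    have "\<exists>\<mu>. prob_space \<mu> \<and> sets \<mu> = sets borel \<and>
        (\<forall>B\<in>sets borel. density_kernel q x B = measure \<mu> B)"
      using Q_kernel by (simp add: markov_kernel_def)
    then obtain \<mu> where "prob_space \<mu>" "sets \<mu> = sets borel"
      and "\<forall>B\<in>sets borel. density_kernel q x B = measure \<mu> B"
      by blast
    then have "density_kernel q x UNIV = 1"
      using prob_space.prob_space[of \<mu>] sets_eq_imp_space_eq[of \<mu> borel] by simp
    then show ?thesis
      by (simp add: density_kernel_def set_lebesgue_integral_def)
  qed
  \<comment> \<open>An integral with the nonzero value 1 cannot be the default value for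
    functions that are not integrable.\<close>
  have q_int: "integrable lebesgue (q x)" for x
    using q_mass[of x] not_integrable_integral_eq[of lebesgue "q x"] by force
  have a_int: "integrable lebesgue (a x)" for x
  proof (rule Bochner_Integration.integrable_bound[OF q_int[of x]])
    show "a x \<in> borel_measurable lebesgue"
      using well_defined by (simp add: nrmh_well_defined_def a_def[abs_def])
  qed (use a_nonneg a_le q_nonneg in auto)
  have a_mass: "(LINT y|lebesgue. a x y) \<le> 1" for x
    using integral_mono[OF a_int q_int, of x x] a_le by (simp add: q_mass)
  have prob: "\<exists>\<mu>. prob_space \<mu> \<and> sets \<mu> = sets borel \<and>
      (\<forall>B\<in>sets borel. nrmh_kernel \<pi> q \<gamma> x B = measure \<mu> B)" for x
    unfolding P_eq by (rule prob_space_density_plus_atom[OF a_int a_nonneg a_mass])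

  have pi_meas: "\<pi> \<in> borel_measurable lebesgue"
    using pi_finite by simp
  have swap_meas: "(\<lambda>(x, y). f y x) \<in> borel_measurable lebesgue"
    if "(\<lambda>(x, y). f x y) \<in> borel_measurable lebesgue" for f :: "real ^ 'n \<Rightarrow> real ^ 'n \<Rightarrow> real"
    using measurable_comp[OF lebesgue_measurable_swap that]
    by (simp add: comp_def case_prod_unfold)
  have pi_fst: "(\<lambda>(x, y :: real ^ 'n). \<pi> x) \<in> borel_measurable lebesgue"
    using measurable_comp[OF lebesgue_measurable_fst pi_meas] by (simp add: comp_def case_prod_unfold)
  have a_meas: "(\<lambda>(x, y). a x y) \<in> borel_measurable lebesgue"
    unfolding a_def
    using pi_fst swap_meas[OF pi_fst] q_measurable swap_meas[OF q_measurable] gamma_measurable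
    by (intro acceptance_density_measurable) (simp_all add: case_prod_unfold)
  have ind_fst: "(\<lambda>p. indicator B (fst p) :: real) \<in> borel_measurable (borel :: ((real ^ 'n) \<times> (real ^ 'n)) measure)"
    and ind_snd: "(\<lambda>p. indicator B (snd p) :: real) \<in> borel_measurable (borel :: ((real ^ 'n) \<times> (real ^ 'n)) measure)"
    if "B \<in> sets borel" for B :: "(real ^ 'n) set"
    using that by (simp_all add: borel_prod[symmetric])
  have ind_fst': "(\<lambda>p. indicator B (fst p) :: real) \<in> borel_measurable (lebesgue :: ((real ^ 'n) \<times> (real ^ 'n)) measure)"
    and ind_snd': "(\<lambda>p. indicator B (snd p) :: real) \<in> borel_measurable (lebesgue :: ((real ^ 'n) \<times> (real ^ 'n)) measure)"
    if "B \<in> sets borel" for B :: "(real ^ 'n) set"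
    using ind_fst[OF that] ind_snd[OF that] by (auto intro!: measurable_completion)

  have kernel: "markov_kernel lebesgue borel (nrmh_kernel \<pi> q \<gamma>)"
    unfolding markov_kernel_def
  proof (intro conjI ballI)
    fix B :: "(real ^ 'n) set" assume B: "B \<in> sets borel"
    have "(\<lambda>p. indicator B (snd p) * (case p of (x, y) \<Rightarrow> a x y)) \<in> borel_measurable lebesgue"
      using ind_snd'[OF B] a_meas by (rule borel_measurable_times)
    note m = lebesgue_section_integral_measurable[OF this] lebesgue_section_integral_measurable[OF a_meas]
    show "(\<lambda>x. nrmh_kernel \<pi> q \<gamma> x B) \<in> borel_measurable lebesgue"
      unfolding P_eq set_lebesgue_integral_def
      by (intro borel_measurable_add borel_measurable_times borel_measurable_diff
          borel_measurable_indicator) (use m B in simp_all)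
  qed (rule prob)

  have borel_kernel: "markov_kernel borel borel (nrmh_kernel \<pi> q \<gamma>)"
    if pi_b: "\<pi> \<in> borel_measurable borel"
      and q_b: "(\<lambda>(x, y). q x y) \<in> borel_measurable borel"
      and g_b: "(\<lambda>(x, y). \<gamma> x y) \<in> borel_measurable borel"
    unfolding markov_kernel_def
  proof (intro conjI ballI)
    fix B :: "(real ^ 'n) set" assume B: "B \<in> sets borel"
    have "(\<lambda>(x, y). q y x) \<in> borel_measurable borel"
      using measurable_comp[OF borel_measurable_swap q_b] by (simp add: comp_def case_prod_unfold)
    moreover have "(\<lambda>p :: (real ^ 'n) \<times> (real ^ 'n). \<pi> (fst p)) \<in> borel_measurable borel"
      "(\<lambda>p :: (real ^ 'n) \<times> (real ^ 'n). \<pi> (snd p)) \<in> borel_measurable borel"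
      using pi_b by (simp_all add: borel_prod[symmetric])
    ultimately have a_b: "(\<lambda>(x, y). a x y) \<in> borel_measurable borel"
      unfolding a_def using q_b g_b by (intro acceptance_density_measurable)
    have ia_b: "(\<lambda>p. indicator B (snd p) * (case p of (x, y) \<Rightarrow> a x y)) \<in> borel_measurable borel"
      using ind_snd[OF B] a_b by (rule borel_measurable_times)
    note m = borel_section_integral_measurable[OF a_b] borel_section_integral_measurable[OF ia_b]
    show "(\<lambda>x. nrmh_kernel \<pi> q \<gamma> x B) \<in> borel_measurable borel"
      unfolding P_eq set_lebesgue_integral_def
      by (intro borel_measurable_add borel_measurable_times borel_measurable_diff
          borel_measurable_indicator) (use m B in \<open>simp_all add: integral_completion\<close>)
  qed (rule prob)

  have s_nonneg: "0 \<le> s x y" for x y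
    by (simp add: s_def a_nonneg pi_nonneg)
  have s_sections: "integrable lebesgue (s x)" for x
    unfolding s_def[abs_def] using a_int[of x] by simp
  have s_meas: "(\<lambda>(x, y). s x y) \<in> borel_measurable lebesgue"
    using borel_measurable_times[OF pi_fst a_meas] by (simp add: s_def case_prod_unfold)
  have s_iterated: "integrable lebesgue (\<lambda>x. LINT y|lebesgue. s x y)"
  proof (rule Bochner_Integration.integrable_bound[OF pi_finite])
    show "(\<lambda>x. LINT y|lebesgue. s x y) \<in> borel_measurable lebesgue"
      using lebesgue_section_integral_measurable[OF s_meas] by simp
    show "AE x in lebesgue. norm (LINT y|lebesgue. s x y) \<le> norm (\<pi> x)"
      using a_mass a_nonneg pi_nonneg
      by (intro AE_I2) (simp add: s_def abs_mult integral_nonneg_AE mult_left_le)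
  qed
  have s_int: "integrable lebesgue (\<lambda>(x, y). s x y)"
    using s_meas s_nonneg s_sections s_iterated by (intro lebesgue_prod_integrableI) auto
  have s_antisym: "s x y - s y x = \<gamma> x y" for x y
  proof (cases "\<pi> x * q x y = 0")
    case True
    then show ?thesis
      using support_sym[of x y] gamma_zero[of x y] by (auto simp: s_def a_def)
  next
    case False
    have s_min: "s x y = min (\<pi> x * q x y) (\<gamma> x y + \<pi> y * q y x)" if "\<pi> x * q x y \<noteq> 0" for x y
    proof -
      have "\<pi> x * q x y > 0"
        using that pi_nonneg[of x] q_nonneg[of x y] by (metis less_eq_real_def mult_nonneg_nonneg)
      then have "(\<pi> x * q x y) * min 1 ((\<gamma> x y + \<pi> y * q y x) / (\<pi> x * q x y)) =
          min (\<pi> x * q x y) (\<gamma> x y + \<pi> y * q y x)"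
        using that by (auto simp add: min_mult_distrib_left)
      with that show ?thesis
        by (simp add: s_def a_def acceptance_def hastings_ratio_def mult_ac)
    qed
    have "\<pi> y * q y x \<noteq> 0"
      using False support_sym[of x y] by blast
    from s_min[OF False] s_min[OF this] show ?thesis
      using gamma_antisym[of x y] by (auto simp: min_def)
  qed

  have invariant: "(LINT x|lebesgue. \<pi> x * nrmh_kernel \<pi> q \<gamma> x B) = (LINT x:B|lebesgue. \<pi> x)"
    if B: "B \<in> sets borel" for B
  proof -
    \<comment> \<open>The flow that starts in \<open>B\<close> and the flow that ends in \<open>B\<close>.\<close>
    define from_B where "from_B p = indicator B (fst p) * (case p of (x, y) \<Rightarrow> s x y)" for p
    define into_B where "into_B p = indicator B (snd p) * (case p of (x, y) \<Rightarrow> s x y)" for p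
    have from_B_int: "integrable lebesgue from_B" and into_B_int: "integrable lebesgue into_B"
      unfolding from_B_def into_B_def
      by (rule Bochner_Integration.integrable_bound[OF s_int];
          use ind_fst'[OF B] ind_snd'[OF B] s_meas in \<open>auto simp: indicator_def\<close>)+
    have into_B_swap: "integrable lebesgue (\<lambda>p. into_B (prod.swap p))"
      "(LINT p|lebesgue. into_B (prod.swap p)) = integral\<^sup>L lebesgue into_B"
      using integrable_distr_eq[OF lebesgue_measurable_swap borel_measurable_integrable[OF into_B_int]]
        integral_distr[OF lebesgue_measurable_swap borel_measurable_integrable[OF into_B_int]] into_B_int
      by (simp_all add: lebesgue_swap)
    have "0 = (LINT p|lebesgue. from_B p - into_B (prod.swap p))"
      using gamma_integral[OF B]
      by (simp add: set_lebesgue_integral_def from_B_def into_B_def case_prod_unfold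
          s_antisym[symmetric] right_diff_distrib indicator_times)
    also have "\<dots> = integral\<^sup>L lebesgue from_B - integral\<^sup>L lebesgue into_B"
      using from_B_int into_B_swap by simp
    finally have balance: "integral\<^sup>L lebesgue into_B = integral\<^sup>L lebesgue from_B" by simp

    \<comment> \<open>The contribution of \<open>x\<close> to the mass of \<open>B\<close> after one step: what it sends into \<open>B\<close>, plus
      its mass if it lies in \<open>B\<close>, minus what then leaves it.
      Flow from \<open>B\<close> to itself is counted in both flow terms and cancels.\<close>
    have split: "\<pi> x * nrmh_kernel \<pi> q \<gamma> x B =
        (LINT y|lebesgue. into_B (x, y)) + indicator B x * \<pi> x - (LINT y|lebesgue. from_B (x, y))" for x
      unfolding P_eq set_lebesgue_integral_def into_B_def from_B_def s_def
      by (simp add: algebra_simps)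
    have pi_B: "integrable lebesgue (\<lambda>x. indicator B x * \<pi> x)"
      using integrable_mult_indicator[of B lebesgue \<pi>] B pi_finite by simp
    show ?thesis
      unfolding split
      using pi_B lebesgue_Fubini[OF into_B_int] lebesgue_Fubini[OF from_B_int]
      by (simp add: balance set_lebesgue_integral_def)
  qed
  show ?thesis
    using kernel borel_kernel invariant by blast
qed

end
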